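(* (Soundness) For every set $\Gamma$ of formulae of $\mathcal{L}_{\succ}$ and every formula $\phi$ of $\mathcal{L}_{\succ}$: if $\Gamma \vdash_{\mathbf{LCR}} \phi$, then $\Gamma \models_{\mathcal{C}_K^{\mathbf{LCR}}} \phi$.
   Context: Fix an integer $m\ge 2$ and let $\mathcal{T}=\{0,\frac{1}{m-1},\dots,\frac{m-2}{m-1},1\}$ with its natural order. For $a,b\in\mathcal{T}$ put $\sim a=1-a$, $a\rightarrow b=\min\{1,1-a+b\}$, $a\odot b=\max\{0,a+b-1\}$. The language $\mathcal{L}_{\succ}$ has a countable set $\Pi$ of propositional variables, the unary connective $\neg$ and the binary connectives $\rightarrow$ and $\succ$; formulae are built as usual. Abbreviations: $\mathbf{t}:=p\rightarrow p$ (for a fixed variable $p$), $\phi\vee\psi:=(\phi\rightarrow\psi)\rightarrow\psi$, $\phi\wedge\psi:=\neg(\neg\phi\vee\neg\psi)$, $\phi\leftrightarrow\psi:=(\phi\rightarrow\psi)\wedge(\psi\rightarrow\phi)$. For $a\in\mathcal{T}$, $\mathbf{J}_a(\phi)$ is a fixed formula built from $\phi$ with $\neg,\rightarrow$ (the Rosser–Turquette $J$-operator of Łukasiewicz $m$-valued logic) whose value is $1$ if the value of $\phi$ is $a$ and $0$ otherwise; $\mathbf{I}_a(\phi):=\mathbf{J}_a(\phi)\vee\dots\vee\mathbf{J}_1(\phi)$ (disjunction over all $b\in\mathcal{T}$ with $b\ge a$), whose value is $1$ if the value of $\phi$ is $\ge a$ and $0$ otherwise. Iterated implication: $\rightarrow_{i=1}^{0}(\phi_i,\psi):=\psi$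 and $\rightarrow_{i=1}^{k}(\phi_i,\psi):=\phi_k\rightarrow(\rightarrow_{i=1}^{k-1}(\phi_i,\psi))$. A Kripke $\mathbf{LCR}$ model is $\mathfrak{J}=\langle W,\mathcal{A},\{R_X:X\in\mathcal{A}\},\nu\rangle$ with $W$ a nonempty set, $\mathcal{A}\subseteq(\mathcal{P}(W))^m$, each $R_X:W\times W\to\mathcal{T}$ (write $xR_Xy$ for its value), and $\nu:\Pi\times W\to\mathcal{T}$ (write $\nu_x(p)$). It is extended to all formulae by $\nu_x(\neg\phi)=\sim\nu_x(\phi)$, $\nu_x(\phi\rightarrow\psi)=\nu_x(\phi)\rightarrow\nu_x(\psi)$, $\nu_x(\phi\succ\psi)=\bigwedge\{xR_{|\phi|}y\rightarrow\nu_y(\psi):y\in W\}$ (infimum), where $|\phi|=(|\phi|_1,\dots,|\phi|_m)$ with $|\phi|_i=\{x\in W:\nu_x(\phi)=\frac{i-1}{m-1}\}$ (the semantics presupposes $|\phi|\in\mathcal{A}$). For a class $\mathcal{C}$ of such models, $\Sigma\models_{\mathcal{C}}\phi$ means: for every model in $\mathcal{C}$ and every world $w$, if $\nu_w(\psi)=1$ for all $\psi\in\Sigma$ then $\nu_w(\phi)=1$. $\mathcal{C}_K^{\mathbf{LCR}}$ is the class of all Kripke $\mathbf{LCR}$ models. The system $\mathbf{LCR}$: all $\mathcal{L}_{\succ}$-instances of the axioms of a (complete) axiomatization of Łukasiewicz $m$-valued propositional logic $\mathbf{L}$ with modus ponens (MP), plus the axioms A1: $(\phi\succ(\psi\wedge\theta))\rightarrow((\phi\succ\psi)\wedge(\phi\succ\theta))$;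 A2: $((\phi\succ\psi)\wedge(\phi\succ\theta))\rightarrow(\phi\succ(\psi\wedge\theta))$; A3: $\phi\succ\mathbf{t}$; and the rules (RCEA): from $\phi\leftrightarrow\psi$ infer $(\phi\succ\theta)\leftrightarrow(\psi\succ\theta)$; (RCEC): from $\phi\leftrightarrow\psi$ infer $(\theta\succ\phi)\leftrightarrow(\theta\succ\psi)$; $(\mathrm{R}_a)$ for each $a\in\mathcal{T}$: from $\rightarrow_{i=1}^{m}(\mathbf{I}_{a_i\odot b}(\gamma_i),\mathbf{I}_{a\odot b}(\gamma))$ for every $b\in\mathcal{T}$, infer $\rightarrow_{i=1}^{m}(\mathbf{I}_{a_i}(\phi\succ\gamma_i),\mathbf{I}_{a}(\phi\succ\gamma))$, where $a_i=\frac{m-i}{m-1}$. $\vdash_{\mathbf{LCR}}\phi$ means $\phi$ is a theorem of $\mathbf{LCR}$; $\Gamma\vdash_{\mathbf{LCR}}\phi$ means there is a finite sequence ending with $\phi$ each member of which is a theorem of $\mathbf{LCR}$, a member of $\Gamma$, or obtained by MP from earlier members. *)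

theory Defs
  imports Complex_Main
begin

section \<open>Truth values\<close>

definition tv :: "nat \<Rightarrow> nat \<Rightarrow> real" where
  "tv m k = real k / (real m - 1)"

definition TV :: "nat \<Rightarrow> real set" where
  "TV m = tv m ` {0..<m}"

definition lneg :: "real \<Rightarrow> real" where
  "lneg a = 1 - a"

definition limp :: "real \<Rightarrow> real \<Rightarrow> real" where
  "limp a b = min 1 (1 - a + b)"

definition lstr :: "real \<Rightarrow> real \<Rightarrow> real" where
  "lstr a b = max 0 (a + b - 1)"

section \<open>Lukasiewicz propositional logic\<close>

datatype pfm = PVar nat | PNeg pfm | PImp pfm pfm

primrec psubst :: "(nat \<Rightarrow> pfm) \<Rightarrow> pfm \<Rightarrow> pfm" where
  "psubst s (PVar p) = s p"
| "psubst s (PNeg \<alpha>) = PNeg (psubst s \<alpha>)"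
| "psubst s (PImp \<alpha> \<beta>) = PImp (psubst s \<alpha>) (psubst s \<beta>)"

primrec peval :: "(nat \<Rightarrow> real) \<Rightarrow> pfm \<Rightarrow> real" where
  "peval v (PVar p) = v p"
| "peval v (PNeg \<alpha>) = lneg (peval v \<alpha>)"
| "peval v (PImp \<alpha> \<beta>) = limp (peval v \<alpha>) (peval v \<beta>)"

definition L_valid :: "nat \<Rightarrow> pfm \<Rightarrow> bool" where
  "L_valid m \<alpha> \<longleftrightarrow> (\<forall>v. (\<forall>p. v p \<in> TV m) \<longrightarrow> peval v \<alpha> = 1)"

inductive L_thm :: "pfm set \<Rightarrow> pfm \<Rightarrow> bool" for Ax :: "pfm set" where
  L_ax: "\<alpha> \<in> Ax \<Longrightarrow> L_thm Ax (psubst s \<alpha>)"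
| L_mp: "L_thm Ax (PImp \<alpha> \<beta>) \<Longrightarrow> L_thm Ax \<alpha> \<Longrightarrow> L_thm Ax \<beta>"

text \<open>A set of axiom schemata which, with modus ponens as the only rule, axiomatizes exactly the
  tautologies of the \<open>m\<close>-valued logic.\<close>

definition L_axiomatization :: "nat \<Rightarrow> pfm set \<Rightarrow> bool" where
  "L_axiomatization m Ax \<longleftrightarrow> (\<forall>\<alpha>. L_thm Ax \<alpha> \<longleftrightarrow> L_valid m \<alpha>)"

section \<open>The conditional language\<close>

datatype fm = Var nat | Neg fm | Imp fm fm (infixr "\<^bold>\<rightarrow>" 55) | Cond fm fm (infix "\<^bold>\<succ>" 60)

definition Tru :: fm ("\<^bold>t") where
  "\<^bold>t = (Var 0 \<^bold>\<rightarrow> Var 0)"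

definition Dis :: "fm \<Rightarrow> fm \<Rightarrow> fm" (infixl "\<^bold>\<or>" 57) where
  "\<phi> \<^bold>\<or> \<psi> = ((\<phi> \<^bold>\<rightarrow> \<psi>) \<^bold>\<rightarrow> \<psi>)"

definition Con :: "fm \<Rightarrow> fm \<Rightarrow> fm" (infixl "\<^bold>\<and>" 58) where
  "\<phi> \<^bold>\<and> \<psi> = Neg (Neg \<phi> \<^bold>\<or> Neg \<psi>)"

definition Iff :: "fm \<Rightarrow> fm \<Rightarrow> fm" (infix "\<^bold>\<leftrightarrow>" 54) where
  "\<phi> \<^bold>\<leftrightarrow> \<psi> = ((\<phi> \<^bold>\<rightarrow> \<psi>) \<^bold>\<and> (\<psi> \<^bold>\<rightarrow> \<phi>))"

primrec inst :: "(nat \<Rightarrow> fm) \<Rightarrow> pfm \<Rightarrow> fm" where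
  "inst s (PVar p) = s p"
| "inst s (PNeg \<alpha>) = Neg (inst s \<alpha>)"
| "inst s (PImp \<alpha> \<beta>) = (inst s \<alpha> \<^bold>\<rightarrow> inst s \<beta>)"

text \<open>The operators \<open>J\<close> are given by templates: \<open>Jt a\<close> is a propositional formula, and
  \<open>J\<close> of \<open>\<phi>\<close> is the result of putting \<open>\<phi>\<close> for every variable of \<open>Jt a\<close>, hence a formula built from
  \<open>\<phi>\<close> with negation and implication only.\<close>

definition J_templates :: "nat \<Rightarrow> (real \<Rightarrow> pfm) \<Rightarrow> bool" where
  "J_templates m Jt \<longleftrightarrow>
     (\<forall>a\<in>TV m. \<forall>x\<in>TV m. peval (\<lambda>_. x) (Jt a) = (if x = a then 1 else 0))"

definition Jop :: "(real \<Rightarrow> pfm) \<Rightarrow> real \<Rightarrow> fm \<Rightarrow> fm" where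
  "Jop Jt a \<phi> = inst (\<lambda>_. \<phi>) (Jt a)"

text \<open>The clause for the empty list is a dummy: \<open>Iop\<close> is only used for truth values \<open>a \<le> 1\<close>, for
  which the list below is not empty.\<close>

fun disj_list :: "fm list \<Rightarrow> fm" where
  "disj_list [] = Neg \<^bold>t"
| "disj_list (\<phi> # \<phi>s) = foldl (\<^bold>\<or>) \<phi> \<phi>s"

definition Iop :: "nat \<Rightarrow> (real \<Rightarrow> pfm) \<Rightarrow> real \<Rightarrow> fm \<Rightarrow> fm" where
  "Iop m Jt a \<phi> = disj_list (map (\<lambda>b. Jop Jt b \<phi>) (filter (\<lambda>b. a \<le> b) (map (tv m) [0..<m])))"

primrec iter_imp :: "nat \<Rightarrow> (nat \<Rightarrow> fm) \<Rightarrow> fm \<Rightarrow> fm" where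
  "iter_imp 0 \<phi> \<psi> = \<psi>"
| "iter_imp (Suc k) \<phi> \<psi> = (\<phi> (Suc k) \<^bold>\<rightarrow> iter_imp k \<phi> \<psi>)"

section \<open>Kripke models\<close>

text \<open>The \<open>m\<close>-tuples of sets of worlds that index the accessibility relations are lists of
  length \<open>m\<close>.\<close>

record 'w lcr_model =
  worlds :: "'w set"
  index :: "'w set list set"
  rel :: "'w set list \<Rightarrow> 'w \<Rightarrow> 'w \<Rightarrow> real"
  pval :: "nat \<Rightarrow> 'w \<Rightarrow> real"

primrec val :: "nat \<Rightarrow> 'w lcr_model \<Rightarrow> fm \<Rightarrow> 'w \<Rightarrow> real" where
  "val m M (Var p) = (\<lambda>x. pval M p x)"
| "val m M (Neg \<phi>) = (\<lambda>x. lneg (val m M \<phi> x))"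
| "val m M (\<phi> \<^bold>\<rightarrow> \<psi>) = (\<lambda>x. limp (val m M \<phi> x) (val m M \<psi> x))"
| "val m M (\<phi> \<^bold>\<succ> \<psi>) = (\<lambda>x. INF y\<in>worlds M.
     limp (rel M (map (\<lambda>i. {z \<in> worlds M. val m M \<phi> z = tv m i}) [0..<m]) x y) (val m M \<psi> y))"

definition ext :: "nat \<Rightarrow> 'w lcr_model \<Rightarrow> fm \<Rightarrow> 'w set list" where
  "ext m M \<phi> = map (\<lambda>i. {x \<in> worlds M. val m M \<phi> x = tv m i}) [0..<m]"

lemma val_Cond:
  "val m M (\<phi> \<^bold>\<succ> \<psi>) x =
     (INF y\<in>worlds M. limp (rel M (ext m M \<phi>) x y) (val m M \<psi> y))"
  by (simp add: ext_def)

definition LCR_models :: "nat \<Rightarrow> 'w lcr_model set" where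
  "LCR_models m = {M.
     worlds M \<noteq> {} \<and>
     index M \<subseteq> {X. length X = m \<and> set X \<subseteq> Pow (worlds M)} \<and>
     (\<forall>X\<in>index M. \<forall>x\<in>worlds M. \<forall>y\<in>worlds M. rel M X x y \<in> TV m) \<and>
     (\<forall>p. \<forall>x\<in>worlds M. pval M p x \<in> TV m) \<and>
     (\<forall>\<phi>. ext m M \<phi> \<in> index M)}"

definition entails :: "nat \<Rightarrow> 'w lcr_model set \<Rightarrow> fm set \<Rightarrow> fm \<Rightarrow> bool" where
  "entails m C \<Sigma> \<phi> \<longleftrightarrow>
     (\<forall>M\<in>C. \<forall>w\<in>worlds M. (\<forall>\<psi>\<in>\<Sigma>. val m M \<psi> w = 1) \<longrightarrow> val m M \<phi> w = 1)"

section \<open>The system LCR\<close>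

inductive LCR_thm :: "nat \<Rightarrow> pfm set \<Rightarrow> (real \<Rightarrow> pfm) \<Rightarrow> fm \<Rightarrow> bool"
  for m :: nat and Ax :: "pfm set" and Jt :: "real \<Rightarrow> pfm" where
  L: "\<alpha> \<in> Ax \<Longrightarrow> LCR_thm m Ax Jt (inst s \<alpha>)"
| A1: "LCR_thm m Ax Jt ((\<phi> \<^bold>\<succ> (\<psi> \<^bold>\<and> \<theta>)) \<^bold>\<rightarrow> ((\<phi> \<^bold>\<succ> \<psi>) \<^bold>\<and> (\<phi> \<^bold>\<succ> \<theta>)))"
| A2: "LCR_thm m Ax Jt (((\<phi> \<^bold>\<succ> \<psi>) \<^bold>\<and> (\<phi> \<^bold>\<succ> \<theta>)) \<^bold>\<rightarrow> (\<phi> \<^bold>\<succ> (\<psi> \<^bold>\<and> \<theta>)))"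
| A3: "LCR_thm m Ax Jt (\<phi> \<^bold>\<succ> \<^bold>t)"
| MP: "LCR_thm m Ax Jt (\<phi> \<^bold>\<rightarrow> \<psi>) \<Longrightarrow> LCR_thm m Ax Jt \<phi> \<Longrightarrow> LCR_thm m Ax Jt \<psi>"
| RCEA: "LCR_thm m Ax Jt (\<phi> \<^bold>\<leftrightarrow> \<psi>) \<Longrightarrow> LCR_thm m Ax Jt ((\<phi> \<^bold>\<succ> \<theta>) \<^bold>\<leftrightarrow> (\<psi> \<^bold>\<succ> \<theta>))"
| RCEC: "LCR_thm m Ax Jt (\<phi> \<^bold>\<leftrightarrow> \<psi>) \<Longrightarrow> LCR_thm m Ax Jt ((\<theta> \<^bold>\<succ> \<phi>) \<^bold>\<leftrightarrow> (\<theta> \<^bold>\<succ> \<psi>))"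
| Ra: "a \<in> TV m \<Longrightarrow>
    (\<And>b. b \<in> TV m \<Longrightarrow> LCR_thm m Ax Jt
       (iter_imp m (\<lambda>i. Iop m Jt (lstr (tv m (m - i)) b) (\<gamma>s i)) (Iop m Jt (lstr a b) \<gamma>))) \<Longrightarrow>
    LCR_thm m Ax Jt
      (iter_imp m (\<lambda>i. Iop m Jt (tv m (m - i)) (\<phi> \<^bold>\<succ> \<gamma>s i)) (Iop m Jt a (\<phi> \<^bold>\<succ> \<gamma>)))"

definition LCR_derives :: "nat \<Rightarrow> pfm set \<Rightarrow> (real \<Rightarrow> pfm) \<Rightarrow> fm set \<Rightarrow> fm \<Rightarrow> bool" where
  "LCR_derives m Ax Jt \<Gamma> \<phi> \<longleftrightarrow>
     (\<exists>s. s \<noteq> [] \<and> last s = \<phi> \<and>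
        (\<forall>i<length s. LCR_thm m Ax Jt (s ! i) \<or> s ! i \<in> \<Gamma> \<or>
           (\<exists>j<i. \<exists>k<i. s ! j = (s ! k \<^bold>\<rightarrow> s ! i))))"

section \<open>Existence of axiomatizations and of J-operators\<close>

lemma psubst_eval: "peval v (psubst s \<alpha>) = peval (\<lambda>p. peval v (s p)) \<alpha>"
  by (induction \<alpha>) auto

lemma TV_closed:
  assumes "m \<ge> 2" "a \<in> TV m" "b \<in> TV m"
  shows "lneg a \<in> TV m" "limp a b \<in> TV m"
proof -
  obtain i j where ij: "i < m" "j < m" "a = tv m i" "b = tv m j"
    using assms by (auto simp: TV_def)
  have pos: "real m - 1 > 0" using assms by simp
  have "lneg a = tv m (m - 1 - i)"
    using ij pos by (simp add: lneg_def tv_def of_nat_diff field_simps)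
  moreover have "m - 1 - i < m" using ij by simp
  ultimately show "lneg a \<in> TV m" by (auto simp: TV_def)
  define k where "k = (if i \<le> j then m - 1 else m - 1 - i + j)"
  have "limp a b = tv m k"
  proof (cases "i \<le> j")
    case True
    then have "a \<le> b" using ij pos by (simp add: tv_def divide_right_mono)
    then show ?thesis using True pos by (simp add: limp_def tv_def k_def of_nat_diff)
  next
    case False
    then have "b \<le> a" using ij pos by (simp add: tv_def divide_right_mono)
    have "real k = real m - 1 - real i + real j" using False ij by (simp add: k_def)
    then have "tv m k = (real m - 1) / (real m - 1) - a + b"
      unfolding ij tv_def by (simp only: diff_divide_distrib add_divide_distrib)
    then have "1 - a + b = tv m k" using pos by simp
    with \<open>b \<le> a\<close> show ?thesis by (simp add: limp_def)
  qed
  moreover have "k < m" using ij by (auto simp: k_def)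
  ultimately show "limp a b \<in> TV m" by (auto simp: TV_def)
qed

lemma peval_TV: "m \<ge> 2 \<Longrightarrow> (\<And>p. v p \<in> TV m) \<Longrightarrow> peval v \<alpha> \<in> TV m"
  by (induction \<alpha>) (auto intro: TV_closed)

lemma TV_le_1: "m \<ge> 2 \<Longrightarrow> a \<in> TV m \<Longrightarrow> 0 \<le> a \<and> a \<le> 1"
  by (auto simp: TV_def tv_def field_simps)

lemma L_axiomatization_exists:
  assumes "m \<ge> 2"
  shows "L_axiomatization m {\<alpha>. L_valid m \<alpha>}"
proof -
  have sound: "L_valid m \<alpha>" if "L_thm {\<alpha>. L_valid m \<alpha>} \<alpha>" for \<alpha>
    using that
  proof induction
    case (L_ax \<alpha> s)
    then have "L_valid m \<alpha>" by simp
    then show ?case unfolding L_valid_def psubst_eval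
      by (simp add: peval_TV[OF assms])
  next
    case (L_mp \<alpha> \<beta>)
    show ?case unfolding L_valid_def
    proof (intro allI impI)
      fix v :: "nat \<Rightarrow> real" assume v: "\<forall>p. v p \<in> TV m"
      have "limp (peval v \<alpha>) (peval v \<beta>) = 1" "peval v \<alpha> = 1"
        using L_mp.IH[unfolded L_valid_def, THEN spec, THEN mp, OF v] by simp_all
      moreover have "peval v \<beta> \<le> 1" using TV_le_1[OF assms peval_TV[OF assms, of v \<beta>]] v by simp
      ultimately show "peval v \<beta> = 1" by (simp add: limp_def)
    qed
  qed
  have id: "psubst PVar \<alpha> = \<alpha>" for \<alpha> by (induction \<alpha>) auto
  have "L_thm {\<alpha>. L_valid m \<alpha>} \<alpha>" if "L_valid m \<alpha>" for \<alpha>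
    using L_thm.L_ax[of \<alpha> "{\<alpha>. L_valid m \<alpha>}" PVar] that unfolding id by blast
  with sound show ?thesis unfolding L_axiomatization_def by blast
qed

text \<open>\<open>thr q i\<close> takes the value of \<open>q x - i\<close> truncated to the unit interval, where \<open>x\<close> is the
  value of the variable.\<close>

primrec thr :: "nat \<Rightarrow> int \<Rightarrow> pfm" where
  "thr 0 i = (if i < 0 then PImp (PVar 0) (PVar 0) else PNeg (PImp (PVar 0) (PVar 0)))"
| "thr (Suc q) i =
     PNeg (PImp (PImp (PNeg (thr q i)) (PVar 0)) (PNeg (thr q (i - 1))))"

lemma clamp_step:
  fixes t x :: real
  assumes "0 \<le> x" "x \<le> 1"
  shows "1 - min 1 (1 - min 1 (1 - (1 - max 0 (min 1 t)) + x) + (1 - max 0 (min 1 (t + 1))))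
    = max 0 (min 1 (t + x))"
proof -
  consider "t \<le> -1" | "-1 \<le> t" "t \<le> 0" | "0 \<le> t" "t \<le> 1" | "1 \<le> t" by linarith
  then show ?thesis
  proof cases
    case 1
    then have "max 0 (min 1 t) = 0" "max 0 (min 1 (t + 1)) = 0" by auto
    then show ?thesis using 1 assms by simp
  next
    case 2
    then have "max 0 (min 1 t) = 0" "max 0 (min 1 (t + 1)) = t + 1" by auto
    then show ?thesis using 2 assms by (simp add: min_def max_def)
  next
    case 3
    then have "max 0 (min 1 t) = t" "max 0 (min 1 (t + 1)) = 1" by auto
    then show ?thesis using 3 assms by (simp add: min_def max_def)
  next
    case 4
    then have "max 0 (min 1 t) = 1" "max 0 (min 1 (t + 1)) = 1" by auto
    then show ?thesis using 4 assms by simp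
  qed
qed

lemma peval_thr:
  assumes "0 \<le> x" "x \<le> 1"
  shows "peval (\<lambda>_. x) (thr q i) = max 0 (min 1 (real q * x - of_int i))"
proof (induction q arbitrary: i)
  case 0
  have "i < 0 \<Longrightarrow> real_of_int i \<le> -1" by linarith
  then show ?case by (auto simp: limp_def lneg_def)
next
  case (Suc q)
  define t where "t = real q * x - of_int i"
  have 1: "peval (\<lambda>_. x) (thr q i) = max 0 (min 1 t)"
    and 2: "peval (\<lambda>_. x) (thr q (i - 1)) = max 0 (min 1 (t + 1))"
    and 3: "real (Suc q) * x - of_int i = t + x"
    by (simp_all add: Suc t_def algebra_simps)
  show ?case unfolding 3 thr.simps peval.simps 1 2 limp_def lneg_def
    by (rule clamp_step[OF assms])
qed

lemma J_templates_exist: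
  assumes "m \<ge> 2"
  shows "\<exists>Jt. J_templates m Jt"
proof
  define k where "k a = (\<lfloor>a * (real m - 1)\<rfloor> :: int)" for a :: real
  define Jt where "Jt a = PNeg (PImp (thr (m - 1) (k a - 1)) (thr (m - 1) (k a)))" for a
  show "J_templates m Jt" unfolding J_templates_def
  proof (intro ballI)
    fix a x assume "a \<in> TV m" "x \<in> TV m"
    then obtain i j where ij: "i < m" "j < m" "a = tv m i" "x = tv m j"
      by (auto simp: TV_def)
    have pos: "real m - 1 > 0" using assms by simp
    have x: "0 \<le> x" "x \<le> 1" using TV_le_1[OF assms \<open>x \<in> TV m\<close>] by auto
    have ka: "k a = int i" using ij pos by (simp add: k_def tv_def)
    have mx: "real (m - 1) * x = real j" using ij pos assms by (simp add: tv_def of_nat_diff)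
    have v: "peval (\<lambda>_. x) (thr (m - 1) c) = max 0 (min 1 (real j - of_int c))" for c
      using peval_thr[OF x, of "m - 1" c] by (simp only: mx)
    have eq: "x = a \<longleftrightarrow> j = i" using ij pos by (simp add: tv_def)
    have val: "peval (\<lambda>_. x) (Jt a) =
        lneg (limp (max 0 (min 1 (real j - real i + 1))) (max 0 (min 1 (real j - real i))))"
      by (simp only: Jt_def peval.simps v ka of_int_diff of_int_1 of_int_of_nat_eq diff_diff_eq2
          diff_add_eq)
    consider "j = i" | "real j + 1 \<le> real i" | "real j \<ge> real i + 1" by linarith
    then show "peval (\<lambda>_. x) (Jt a) = (if x = a then 1 else 0)"
    proof cases
      case 1
      then show ?thesis by (simp add: val eq limp_def lneg_def)
    next
      case 2
      then have "x \<noteq> a" using eq by auto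
      with 2 show ?thesis by (simp add: val limp_def lneg_def)
    next
      case 3
      then have "x \<noteq> a" using eq by auto
      with 3 show ?thesis by (simp add: val limp_def lneg_def)
    qed
  qed
qed

end

theory Submission
  imports Defs
begin

text \<open>Soundness is proved by showing that every theorem has value 1 at every world. The interesting
  case is the rule \<open>R\<^sub>a\<close>: by residuation, \<open>\<phi> \<succ> \<gamma>\<close> has value at least \<open>a\<close> at \<open>x\<close> iff \<open>\<gamma>\<close> has value at
  least \<open>a \<odot> b\<close> at every world \<open>y\<close>, where \<open>b\<close> is the degree to which \<open>y\<close> is accessible from \<open>x\<close>; hence
  the premise of the rule for this \<open>b\<close>, evaluated at \<open>y\<close>, gives the conclusion at \<open>x\<close>.\<close>

lemma finite_TV: "finite (TV m)"
  by (simp add: TV_def)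

lemma limp_eq_1_iff: "limp a b = 1 \<longleftrightarrow> a \<le> b"
  by (auto simp: limp_def)

text \<open>Both sides reduce to \<open>c + a - 1 \<le> b\<close>: the bound
  \<open>c \<le> 1\<close> absorbs the truncation in \<open>limp\<close>, and
  \<open>0 \<le> b\<close> the one in \<open>lstr\<close>.\<close>

lemma limp_residuation: "0 \<le> b \<Longrightarrow> c \<le> 1 \<Longrightarrow> c \<le> limp a b \<longleftrightarrow> lstr c a \<le> b"
  by (auto simp: limp_def lstr_def)

lemma val_inst: "val m M (inst s \<alpha>) x = peval (\<lambda>p. val m M (s p) x) \<alpha>"
  by (induction \<alpha>) auto

locale lcr =
  fixes m :: nat and M :: "'w lcr_model"
  assumes m_ge_2: "m \<ge> 2" and model: "M \<in> LCR_models m"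
begin

lemma worlds_nonempty: "worlds M \<noteq> {}"
  using model by (simp add: LCR_models_def)

lemma rel_ext_TV: "x \<in> worlds M \<Longrightarrow> y \<in> worlds M \<Longrightarrow> rel M (ext m M \<phi>) x y \<in> TV m"
  using model by (auto simp: LCR_models_def)

lemma val_TV: "x \<in> worlds M \<Longrightarrow> val m M \<phi> x \<in> TV m"
proof (induction \<phi> arbitrary: x)
  case (Var p)
  then show ?case using model by (simp add: LCR_models_def)
next
  case (Cond \<phi> \<psi>)
  let ?S = "(\<lambda>y. limp (rel M (ext m M \<phi>) x y) (val m M \<psi> y)) ` worlds M"
  have "?S \<subseteq> TV m"
    using Cond by (auto intro!: TV_closed m_ge_2 rel_ext_TV)
  moreover from this have "finite ?S" using finite_TV finite_subset by blast
  \<comment> \<open>Finitely many truth values: the infimum is a minimum even over infinitely many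
    worlds, hence itself a truth value.\<close>
  moreover from this have "Inf ?S \<in> ?S"
    using worlds_nonempty by (simp only: cInf_eq_Min Min_in image_is_empty not_False_eq_True)
  ultimately show ?case unfolding val_Cond by blast
qed (auto intro: TV_closed m_ge_2)

lemma val_bounds:
  assumes "x \<in> worlds M"
  shows "0 \<le> val m M \<phi> x" "val m M \<phi> x \<le> 1"
  using TV_le_1[OF m_ge_2 val_TV[OF assms]] by auto

text \<open>A lower bound of an infimum bounds every member, and residuation then moves the
  accessibility degree to the left. All the modal cases below compare conditionals through such
  thresholds or through \<open>ext\<close>.\<close>

lemma le_val_Cond_iff:
  assumes x: "x \<in> worlds M" and c: "c \<le> 1"
  shows "c \<le> val m M (\<phi> \<^bold>\<succ> \<psi>) x \<longleftrightarrow>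
    (\<forall>y\<in>worlds M. lstr c (rel M (ext m M \<phi>) x y) \<le> val m M \<psi> y)"
proof -
  \<comment> \<open>Real infima are only conditionally complete, so the bound 0 has to be
    supplied.\<close>
  have "bdd_below ((\<lambda>y. limp (rel M (ext m M \<phi>) x y) (val m M \<psi> y)) ` worlds M)"
  proof (rule bdd_belowI2)
    fix y assume "y \<in> worlds M"
    then show "0 \<le> limp (rel M (ext m M \<phi>) x y) (val m M \<psi> y)"
      using TV_le_1[OF m_ge_2 rel_ext_TV[OF x, of y]] val_bounds[of y \<psi>]
      by (fastforce simp: limp_def)
  qed
  then have "c \<le> val m M (\<phi> \<^bold>\<succ> \<psi>) x \<longleftrightarrow>
      (\<forall>y\<in>worlds M. c \<le> limp (rel M (ext m M \<phi>) x y) (val m M \<psi> y))"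
    unfolding val_Cond by (rule le_cINF_iff[OF worlds_nonempty])
  then show ?thesis using limp_residuation[OF val_bounds(1) c] by simp
qed

text \<open>The antecedent enters only through \<open>ext\<close>; the threshold to compare with is
  the left-hand value itself.\<close>

lemma val_Cond_mono:
  assumes x: "x \<in> worlds M" and eq: "ext m M \<phi> = ext m M \<phi>'"
    and le: "\<And>y. y \<in> worlds M \<Longrightarrow> val m M \<psi> y \<le> val m M \<psi>' y"
  shows "val m M (\<phi> \<^bold>\<succ> \<psi>) x \<le> val m M (\<phi>' \<^bold>\<succ> \<psi>') x"
  using le_val_Cond_iff[OF x val_bounds(2)[OF x], of "\<phi> \<^bold>\<succ> \<psi>" \<phi> \<psi>]
    le_val_Cond_iff[OF x val_bounds(2)[OF x], of "\<phi> \<^bold>\<succ> \<psi>" \<phi>' \<psi>'] eq le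
  by fastforce

lemma val_Dis:
  "x \<in> worlds M \<Longrightarrow> val m M (\<phi> \<^bold>\<or> \<psi>) x = max (val m M \<phi> x) (val m M \<psi> x)"
  using val_bounds(2)[of x \<phi>] val_bounds(2)[of x \<psi>] by (auto simp: Dis_def limp_def)

lemma val_Con:
  "x \<in> worlds M \<Longrightarrow> val m M (\<phi> \<^bold>\<and> \<psi>) x = min (val m M \<phi> x) (val m M \<psi> x)"
  by (auto simp: Con_def val_Dis lneg_def)

lemma val_Tru: "val m M \<^bold>t x = 1"
  by (simp add: Tru_def limp_def)

lemma val_Imp_eq_1_iff: "val m M (\<phi> \<^bold>\<rightarrow> \<psi>) x = 1 \<longleftrightarrow> val m M \<phi> x \<le> val m M \<psi> x"
  by (simp add: limp_eq_1_iff)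

lemma val_Iff_eq_1_iff:
  assumes "x \<in> worlds M"
  shows "val m M (\<phi> \<^bold>\<leftrightarrow> \<psi>) x = 1 \<longleftrightarrow> val m M \<phi> x = val m M \<psi> x"
  using assms by (auto simp: Iff_def val_Con limp_def)

lemma val_disj_list:
  assumes x: "x \<in> worlds M" and "\<And>\<psi>. \<psi> \<in> set \<psi>s \<Longrightarrow> val m M \<psi> x \<in> {0, 1}"
  shows "val m M (disj_list \<psi>s) x = (if \<exists>\<psi>\<in>set \<psi>s. val m M \<psi> x = 1 then 1 else 0)"
proof (cases \<psi>s)
  case Nil
  then show ?thesis using val_Tru by (simp add: lneg_def)
next
  case (Cons \<chi> \<chi>s)
  \<comment> \<open>The head is generalized because \<open>foldl\<close> replaces it by a growing
    disjunction.\<close>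
  have "val m M (foldl (\<^bold>\<or>) \<chi> \<chi>s) x = (if \<exists>\<psi>\<in>set (\<chi> # \<chi>s). val m M \<psi> x = 1 then 1 else 0)"
    if "\<And>\<psi>. \<psi> \<in> set (\<chi> # \<chi>s) \<Longrightarrow> val m M \<psi> x \<in> {0, 1}" for \<chi> \<chi>s
    using that
  proof (induction \<chi>s arbitrary: \<chi>)
    case Nil
    then show ?case by auto
  next
    case (Cons \<theta> \<chi>s)
    have "val m M (\<chi> \<^bold>\<or> \<theta>) x = (if val m M \<chi> x = 1 \<or> val m M \<theta> x = 1 then 1 else 0)"
      using Cons.prems[of \<chi>] Cons.prems[of \<theta>] by (auto simp: val_Dis x)
    moreover from this have "val m M \<psi> x \<in> {0, 1}" if "\<psi> \<in> set ((\<chi> \<^bold>\<or> \<theta>) # \<chi>s)" for \<psi>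
      using that Cons.prems by auto
    ultimately show ?case using Cons.IH[of "\<chi> \<^bold>\<or> \<theta>"] by simp
  qed
  with Cons assms show ?thesis by simp
qed

text \<open>On the values 0 and 1, Lukasiewicz implication is classical implication.\<close>

lemma val_iter_imp:
  assumes "\<And>i. i \<in> {1..k} \<Longrightarrow> val m M (\<phi>s i) x \<in> {0, 1}" and "val m M \<psi> x \<in> {0, 1}"
  shows "val m M (iter_imp k \<phi>s \<psi>) x =
    (if (\<forall>i\<in>{1..k}. val m M (\<phi>s i) x = 1) \<longrightarrow> val m M \<psi> x = 1 then 1 else 0)"
  using assms
proof (induction k)
  case 0
  then show ?case by auto
next
  case (Suc k)
  have "val m M (\<phi>s (Suc k)) x = 0 \<or> val m M (\<phi>s (Suc k)) x = 1"
    using Suc.prems(1)[of "Suc k"] by simp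
  moreover have "{1..Suc k} = insert (Suc k) {1..k}" by auto
  moreover have "val m M (iter_imp k \<phi>s \<psi>) x =
      (if (\<forall>i\<in>{1..k}. val m M (\<phi>s i) x = 1) \<longrightarrow> val m M \<psi> x = 1 then 1 else 0)"
    using Suc by simp
  ultimately show ?case
    by (elim disjE) (simp_all add: limp_def del: One_nat_def)
qed

text \<open>The only disjunct that can have value 1 is the one whose index is the value of
  \<open>\<phi>\<close>, and it is listed exactly when \<open>a\<close> is at most that value. For
  \<open>a > 1\<close> the list is empty and both sides are 0.\<close>

lemma val_Iop:
  assumes J: "J_templates m Jt" and x: "x \<in> worlds M"
  shows "val m M (Iop m Jt a \<phi>) x = (if a \<le> val m M \<phi> x then 1 else 0)"
proof -
  have "val m M (Jop Jt b \<phi>) x = (if val m M \<phi> x = b then 1 else 0)" if "b \<in> TV m" for b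
    using J that val_TV[OF x] by (simp add: Jop_def val_inst J_templates_def)
  moreover have "set (map (tv m) [0..<m]) = TV m" by (simp add: TV_def)
  ultimately show ?thesis
    unfolding Iop_def using val_TV[OF x, of \<phi>]
    by (subst val_disj_list[OF x]) (auto simp: TV_def)
qed

lemma val_iter_imp_Iop_eq_1_iff:
  assumes "J_templates m Jt" and "x \<in> worlds M"
  shows "val m M (iter_imp k (\<lambda>i. Iop m Jt (c i) (\<phi>s i)) (Iop m Jt a \<psi>)) x = 1 \<longleftrightarrow>
    ((\<forall>i\<in>{1..k}. c i \<le> val m M (\<phi>s i) x) \<longrightarrow> a \<le> val m M \<psi> x)"
  by (subst val_iter_imp) (auto simp: val_Iop[OF assms])

lemma val_MP:
  assumes "x \<in> worlds M" "val m M (\<phi> \<^bold>\<rightarrow> \<psi>) x = 1" "val m M \<phi> x = 1"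
  shows "val m M \<psi> x = 1"
  using assms(2,3) val_bounds(2)[OF assms(1), of \<psi>] unfolding val_Imp_eq_1_iff by simp

text \<open>An axiom is its own instance under \<open>PVar\<close>, hence valid; the values at
  \<open>x\<close> of the formulae \<open>s p\<close> form an \<open>m\<close>-valued valuation to
  which validity applies.\<close>

lemma val_axiom_inst:
  assumes "L_axiomatization m Ax" "\<alpha> \<in> Ax" "x \<in> worlds M"
  shows "val m M (inst s \<alpha>) x = 1"
proof -
  have "psubst PVar \<beta> = \<beta>" for \<beta> by (induction \<beta>) auto
  then have "L_valid m \<alpha>"
    using L_thm.L_ax[of \<alpha> Ax PVar] assms by (simp add: L_axiomatization_def)
  then show ?thesis using val_TV[OF assms(3)] by (simp add: val_inst L_valid_def)
qed

text \<open>The thresholds \<open>c i\<close> stand for the \<open>tv m (m - i)\<close> of the rule;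
  residuation asks of them only that they are at most 1.\<close>

lemma val_Ra:
  assumes J: "J_templates m Jt" and a: "a \<le> 1" and c: "\<And>i. i \<in> {1..k} \<Longrightarrow> c i \<le> 1"
    and prem: "\<And>b y. b \<in> TV m \<Longrightarrow> y \<in> worlds M \<Longrightarrow>
      val m M (iter_imp k (\<lambda>i. Iop m Jt (lstr (c i) b) (\<gamma>s i)) (Iop m Jt (lstr a b) \<gamma>)) y = 1"
    and x: "x \<in> worlds M"
  shows "val m M (iter_imp k (\<lambda>i. Iop m Jt (c i) (\<phi> \<^bold>\<succ> \<gamma>s i)) (Iop m Jt a (\<phi> \<^bold>\<succ> \<gamma>))) x = 1"
  unfolding val_iter_imp_Iop_eq_1_iff[OF J x] le_val_Cond_iff[OF x a]
proof (intro impI ballI)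
  fix y assume "\<forall>i\<in>{1..k}. c i \<le> val m M (\<phi> \<^bold>\<succ> \<gamma>s i) x" and y: "y \<in> worlds M"
  then have "\<forall>i\<in>{1..k}. lstr (c i) (rel M (ext m M \<phi>) x y) \<le> val m M (\<gamma>s i) y"
    using le_val_Cond_iff[OF x c] by blast
  with prem[OF rel_ext_TV[OF x y] y, unfolded val_iter_imp_Iop_eq_1_iff[OF J y]]
  show "lstr a (rel M (ext m M \<phi>) x y) \<le> val m M \<gamma> y" by blast
qed

text \<open>The induction ranges over all worlds, since in \<open>RCEA\<close>, \<open>RCEC\<close>
  and \<open>Ra\<close> the premises are evaluated at worlds other than \<open>x\<close>.\<close>

lemma LCR_thm_sound:
  assumes Ax: "L_axiomatization m Ax" and J: "J_templates m Jt"
    and "LCR_thm m Ax Jt \<phi>" and "x \<in> worlds M"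
  shows "val m M \<phi> x = 1"
  using assms(3,4)
proof (induction arbitrary: x)
  case (L \<alpha> s)
  then show ?case using val_axiom_inst[OF Ax] by blast
next
  case (A1 \<phi> \<psi> \<theta>)
  then show ?case
    unfolding val_Imp_eq_1_iff val_Con[OF A1]
    by (auto simp: val_Con intro!: val_Cond_mono simp del: val.simps)
next
  case (A2 \<phi> \<psi> \<theta>)
  let ?c = "val m M ((\<phi> \<^bold>\<succ> \<psi>) \<^bold>\<and> (\<phi> \<^bold>\<succ> \<theta>)) x"
  have c: "?c \<le> 1" by (rule val_bounds(2)[OF A2])
  have "?c \<le> val m M (\<phi> \<^bold>\<succ> \<psi>) x" "?c \<le> val m M (\<phi> \<^bold>\<succ> \<theta>) x"
    by (simp_all only: val_Con[OF A2] min.cobounded1 min.cobounded2)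
  \<comment> \<open>With \<open>?c\<close> as common threshold, both conjuncts bound the same
    \<open>lstr\<close> term at each world, so the minimum does too.\<close>
  then have "?c \<le> val m M (\<phi> \<^bold>\<succ> (\<psi> \<^bold>\<and> \<theta>)) x"
    unfolding le_val_Cond_iff[OF A2 c] by (simp add: val_Con)
  then show ?case unfolding val_Imp_eq_1_iff .
next
  case (A3 \<phi>)
  have "1 \<le> val m M (\<phi> \<^bold>\<succ> \<^bold>t) x"
    unfolding le_val_Cond_iff[OF A3 order_refl] val_Tru
    using TV_le_1[OF m_ge_2 rel_ext_TV[OF A3]] by (auto simp: lstr_def)
  then show ?case using val_bounds(2)[OF A3] by (intro antisym)
next
  case (MP \<phi> \<psi>)
  then show ?case using val_MP by blast
next
  case (RCEA \<phi> \<psi> \<theta>)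
  then have "val m M \<phi> y = val m M \<psi> y" if "y \<in> worlds M" for y
    using that val_Iff_eq_1_iff by blast
  \<comment> \<open>Equal extensions select the same accessibility relation.\<close>
  then have "ext m M \<phi> = ext m M \<psi>" by (auto simp: ext_def)
  then show ?case unfolding val_Iff_eq_1_iff[OF RCEA.prems] val_Cond by simp
next
  case (RCEC \<phi> \<psi> \<theta>)
  then have "val m M \<phi> y = val m M \<psi> y" if "y \<in> worlds M" for y
    using that val_Iff_eq_1_iff by blast
  then show ?case
    unfolding val_Iff_eq_1_iff[OF RCEC.prems] val_Cond by simp
next
  case (Ra a \<gamma>s \<gamma> \<phi>)
  \<comment> \<open>Since \<open>i\<close> starts at 1, the index \<open>m - i\<close> stays below
    \<open>m\<close>.\<close>
  have "tv m (m - i) \<le> 1" if "i \<in> {1..m}" for i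
    using TV_le_1[OF m_ge_2, of "tv m (m - i)"] that by (auto simp: TV_def)
  then show ?case
    using Ra TV_le_1[OF m_ge_2 Ra.hyps(1)] by (intro val_Ra[OF J]) auto
qed

text \<open>Members of \<open>\<Gamma>\<close> have value 1 at \<open>w\<close> only, whereas
  theorems have it everywhere. This suffices because modus ponens, the one rule applied to
  \<open>\<Gamma>\<close>, acts at a single world.\<close>

lemma LCR_derives_sound:
  assumes Ax: "L_axiomatization m Ax" and J: "J_templates m Jt"
    and "LCR_derives m Ax Jt \<Gamma> \<phi>" and w: "w \<in> worlds M"
    and \<Gamma>: "\<And>\<psi>. \<psi> \<in> \<Gamma> \<Longrightarrow> val m M \<psi> w = 1"
  shows "val m M \<phi> w = 1"
proof -
  obtain s where s: "s \<noteq> []" "last s = \<phi>"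
    and step: "\<And>i. i < length s \<Longrightarrow> LCR_thm m Ax Jt (s ! i) \<or> s ! i \<in> \<Gamma> \<or>
      (\<exists>j<i. \<exists>k<i. s ! j = (s ! k \<^bold>\<rightarrow> s ! i))"
    using assms(3) unfolding LCR_derives_def by blast
  have "val m M (s ! i) w = 1" if "i < length s" for i
    using that
  proof (induction i rule: less_induct)
    case (less i)
    from step[OF less.prems] consider "LCR_thm m Ax Jt (s ! i)" | "s ! i \<in> \<Gamma>"
      | j k where "j < i" "k < i" "s ! j = (s ! k \<^bold>\<rightarrow> s ! i)" by blast
    then show ?case
    proof cases
      case 1
      then show ?thesis using LCR_thm_sound[OF Ax J _ w] by blast
    next
      case 2
      then show ?thesis by (rule \<Gamma>)
    next
      case 3
      then show ?thesis
        using val_MP[OF w, of "s ! k" "s ! i"] less by (metis less_trans)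
    qed
  qed
  then show ?thesis using s by (metis last_conv_nth diff_less length_greater_0_conv zero_less_one)
qed

end

theorem theorem2p10:
  fixes m :: nat and Ax :: "pfm set" and Jt :: "real \<Rightarrow> pfm"
    and \<Gamma> :: "fm set" and \<phi> :: fm
  assumes "m \<ge> 2"
    and "L_axiomatization m Ax"
    and "J_templates m Jt"
    and "LCR_derives m Ax Jt \<Gamma> \<phi>"
  shows "entails m (LCR_models m :: 'w lcr_model set) \<Gamma> \<phi>"
  unfolding entails_def
proof (intro ballI impI)
  fix M :: "'w lcr_model" and w
  assume M: "M \<in> LCR_models m" and w: "w \<in> worlds M" and \<Gamma>: "\<forall>\<psi>\<in>\<Gamma>. val m M \<psi> w = 1"
  interpret lcr m M by (rule lcr.intro) (fact assms(1), fact M)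
  show "val m M \<phi> w = 1" by (rule LCR_derives_sound[OF assms(2-4) w]) (use \<Gamma> in blast)
qed

end
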